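(* Let $C\subseteq\operatorname{dom}(T)\subseteq\mathbb{R}^n$ be nonempty, closed and convex, and let $T:\operatorname{dom}(T)\to\mathbb{R}^n$ be Lipschitz continuous with constant $L$. Assume that $S_*\neq\varnothing$ and $S_*\subseteq S_{\rm dual}$. Let $(x^k)_{k\in\mathbb{N}}$ be an infinite sequence generated by the Extragradient Algorithm with Normal Vectors (i.e. its stopping test is not satisfied at any $x^k$). Then $(x^k)_{k\in\mathbb{N}}$ converges to a point in $S_*$.
   Context: $\mathbb{R}^n$ carries the Euclidean inner product $\langle\cdot,\cdot\rangle$ and norm $\|\cdot\|$; $\mathbb{N}=\{0,1,2,\dots\}$. $P_C$ is the orthogonal projection onto $C$. For $x\in C$, the normal cone is $\mathcal{N}_C(x)=\{u\in\mathbb{R}^n:\langle u,y-x\rangle\le 0\ \forall y\in C\}$. $S_*=\{x_*\in C:\langle T(x_* ),x-x_*\rangle\ge 0\ \forall x\in C\}$ is the solution set of the variational inequality, and $S_{\rm dual}=\{x_*\in C:\langle T(x),x-x_*\rangle\ge 0\ \forall x\in C\}$ is the solution set of the dual problem. Extragradient Algorithm with Normal Vectors. Parameters: $\delta\in(0,1)$ and $(\beta_k)_{k\in\mathbb{N}}\subset[\check\beta,\hat\beta]$ with $0<\check\beta\le\hat\beta<1/(L+1)$. Take $x^0\in C$. At iteration $k$: (1) Stopping test: if $x^k=P_C(x^k-\beta_kT(x^k))$, stop. Otherwise: (2) Take any $u^k\in\mathcal{N}_C(x^k)$ such that $\|u^k\|\le\delta\,\|x^k-P_C(x^k-\beta_k(T(x^k)+u^k))\|$,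 and set $z^k=P_C(x^k-\beta_k(T(x^k)+u^k))$. (3) Take any $v^k\in\mathcal{N}_C(z^k)$ such that $\|v^k-u^k\|\le\|x^k-z^k\|$, and set $x^{k+1}=P_C(x^k-\beta_k(T(z^k)+v^k))$. Replace $k$ by $k+1$ and return to (1). *)

theory Defs
  imports "HOL-Analysis.Analysis"
begin

definition normal_cone :: "(real ^ 'n) set \<Rightarrow> real ^ 'n \<Rightarrow> (real ^ 'n) set" where
  "normal_cone C x = {u. \<forall>y\<in>C. u \<bullet> (y - x) \<le> 0}"

definition VI_solutions :: "(real ^ 'n) set \<Rightarrow> (real ^ 'n \<Rightarrow> real ^ 'n) \<Rightarrow> (real ^ 'n) set" where
  "VI_solutions C T = {s \<in> C. \<forall>x\<in>C. T s \<bullet> (x - s) \<ge> 0}"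

definition dual_VI_solutions :: "(real ^ 'n) set \<Rightarrow> (real ^ 'n \<Rightarrow> real ^ 'n) \<Rightarrow> (real ^ 'n) set" where
  "dual_VI_solutions C T = {s \<in> C. \<forall>x\<in>C. T x \<bullet> (x - s) \<ge> 0}"

text \<open>
  The orthogonal projection onto a nonempty closed convex set \<open>C\<close> is the library's
  \<^const>\<open>closest_point\<close>. An infinite run is described by its iterates \<open>x k\<close> together with the
  intermediate points \<open>z k\<close> and the normal vectors \<open>u k\<close>, \<open>v k\<close> chosen along the way; the first
  conjunct under the quantifier says that the stopping test fails at \<open>x k\<close>.
\<close>

definition extragradient_normal_run ::
  "(real ^ 'n) set \<Rightarrow> (real ^ 'n \<Rightarrow> real ^ 'n) \<Rightarrow> real \<Rightarrow> (nat \<Rightarrow> real) \<Rightarrow>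
   (nat \<Rightarrow> real ^ 'n) \<Rightarrow> (nat \<Rightarrow> real ^ 'n) \<Rightarrow> (nat \<Rightarrow> real ^ 'n) \<Rightarrow> (nat \<Rightarrow> real ^ 'n) \<Rightarrow> bool"
where
  "extragradient_normal_run C T \<delta> \<beta> x u z v \<longleftrightarrow>
     x 0 \<in> C \<and>
     (\<forall>k. x k \<noteq> closest_point C (x k - \<beta> k *\<^sub>R T (x k)) \<and>
          u k \<in> normal_cone C (x k) \<and>
          norm (u k) \<le> \<delta> * norm (x k - closest_point C (x k - \<beta> k *\<^sub>R (T (x k) + u k))) \<and>
          z k = closest_point C (x k - \<beta> k *\<^sub>R (T (x k) + u k)) \<and>
          v k \<in> normal_cone C (z k) \<and>
          norm (v k - u k) \<le> norm (x k - z k) \<and>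
          x (Suc k) = closest_point C (x k - \<beta> k *\<^sub>R (T (z k) + v k)))"

end

theory Submission imports Defs begin

text \<open>
  Projecting twice from the same point \<open>x\<close>, the solution \<open>s\<close> of the dual problem and the normal
  vector \<open>v\<close> both push the second projection towards \<open>s\<close>, and \<open>\<beta> (L + 1) < 1\<close> absorbs the error
  \<open>T x + u - T z - v\<close>. So the iterates are Fejer monotone with respect to the solution set, and the
  decrease is at least a fixed multiple of \<open>\<parallel>x k - z k\<parallel>\<^sup>2\<close>; hence \<open>x k - z k\<close> and \<open>u k\<close> tend to \<open>0\<close>.
  Passing to the limit in the projection inequality defining \<open>z k\<close> shows that every cluster point
  solves the variational inequality, and Fejer monotonicity with respect to a cluster point gives
  convergence of the whole sequence.
\<close>

lemma extragradient_step_decrease: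
  fixes x a b s :: "'a::euclidean_space"
  assumes C: "closed C" "convex C" "s \<in> C"
    and z: "z = closest_point C (x - t *\<^sub>R a)"
    and y: "y = closest_point C (x - t *\<^sub>R b)"
    and t: "0 \<le> t" "t * M \<le> q"
    and ab: "norm (a - b) \<le> M * norm (x - z)"
    and b: "b \<bullet> (s - z) \<le> 0"
  shows "(norm (y - s))\<^sup>2 \<le> (norm (x - s))\<^sup>2 - (1 - q\<^sup>2) * (norm (x - z))\<^sup>2"
proof -
  have "C \<noteq> {}" using C by auto
  then have "y \<in> C" using closest_point_in_set C y by blast
  \<comment> \<open>Chained obtuse-angle inequalities: the projection \<open>y\<close> is tested
    against \<open>s\<close>, and \<open>z\<close> is tested against \<open>y\<close>. This is why
    \<open>y\<close> must lie in \<open>C\<close>.\<close>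
  have 1: "(x - t *\<^sub>R b - y) \<bullet> (s - y) \<le> 0"
    unfolding y using C by (intro closest_point_dot) auto
  have 2: "(x - t *\<^sub>R a - z) \<bullet> (y - z) \<le> 0"
    unfolding z using C \<open>y \<in> C\<close> by (intro closest_point_dot) auto
  have 3: "t * (b \<bullet> (s - z)) \<le> 0"
    using b t by (simp add: mult_nonneg_nonpos)
  have "(a - b) \<bullet> (y - z) \<le> norm (a - b) * norm (y - z)"
    by (rule norm_cauchy_schwarz)
  also have "\<dots> \<le> M * norm (x - z) * norm (y - z)"
    using ab by (intro mult_right_mono) auto
  finally have "t * ((a - b) \<bullet> (y - z)) \<le> t * (M * norm (x - z) * norm (y - z))"
    using t by (intro mult_left_mono) auto
  also have "\<dots> = t * M * (norm (x - z) * norm (y - z))" by simp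
  also have "\<dots> \<le> q * (norm (x - z) * norm (y - z))"
    using t by (intro mult_right_mono) auto
  finally have 4: "t * ((a - b) \<bullet> (y - z)) \<le> q * (norm (x - z) * norm (y - z))" .
  \<comment> \<open>With \<open>z\<close> moved to the origin, \<open>p\<close>, \<open>r\<close>,
    \<open>w\<close> stand for \<open>x - z\<close>, \<open>y - z\<close>, \<open>s - z\<close>. The
    identity isolates exactly the four inner products bounded above; for free vectors it is linear
    in the pairwise inner products.\<close>
  have expand: "(norm (r - w))\<^sup>2 = (norm (p - w))\<^sup>2 - (norm p)\<^sup>2 - (norm r)\<^sup>2
      + 2 * ((p - t *\<^sub>R b - r) \<bullet> (w - r)) + 2 * ((p - t *\<^sub>R a) \<bullet> r)
      + 2 * (t * (b \<bullet> w)) + 2 * (t * ((a - b) \<bullet> r))" for p r w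
    unfolding power2_norm_eq_inner inner_diff_left inner_diff_right inner_scaleR_left
      inner_commute[of r p] inner_commute[of w p] inner_commute[of w r]
    by argo
  have "(norm (y - s))\<^sup>2 = (norm (x - s))\<^sup>2 - (norm (x - z))\<^sup>2 - (norm (y - z))\<^sup>2
      + 2 * ((x - t *\<^sub>R b - y) \<bullet> (s - y)) + 2 * ((x - t *\<^sub>R a - z) \<bullet> (y - z))
      + 2 * (t * (b \<bullet> (s - z))) + 2 * (t * ((a - b) \<bullet> (y - z)))"
    using expand[of "y - z" "s - z" "x - z"] by (simp add: algebra_simps)
  then have "(norm (y - s))\<^sup>2 \<le> (norm (x - s))\<^sup>2 - (norm (x - z))\<^sup>2 - (norm (y - z))\<^sup>2
      + 2 * (q * (norm (x - z) * norm (y - z)))"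
    using 1 2 3 4 by linarith
  \<comment> \<open>Completing the square in \<open>norm (y - z)\<close> absorbs the cross term at
    the cost of \<open>q\<^sup>2\<close> times the squared norm of \<open>x - z\<close>.\<close>
  also have "\<dots> = (norm (x - s))\<^sup>2 - (1 - q\<^sup>2) * (norm (x - z))\<^sup>2 - (norm (y - z) - q * norm (x - z))\<^sup>2"
    by (simp add: power2_eq_square algebra_simps)
  also have "\<dots> \<le> (norm (x - s))\<^sup>2 - (1 - q\<^sup>2) * (norm (x - z))\<^sup>2" by simp
  finally show ?thesis .
qed

text \<open>A decreasing sequence bounded below converges, so its successive decrements tend to 0;
  they dominate \<open>c * g k\<close>.\<close>

lemma decrement_tendsto_0:
  fixes f g :: "nat \<Rightarrow> real"
  assumes "\<And>k. 0 \<le> f k" "\<And>k. 0 \<le> g k" "0 < c" "\<And>k. f (Suc k) \<le> f k - c * g k"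
  shows "g \<longlonglongrightarrow> 0"
proof -
  have "decseq f"
  proof (rule decseq_SucI)
    fix k
    have "0 \<le> c * g k" using assms by simp
    then show "f (Suc k) \<le> f k" using assms(4)[of k] by linarith
  qed
  then obtain l where l: "f \<longlonglongrightarrow> l" using decseq_convergent assms(1) by blast
  have "(\<lambda>k. (f k - f (Suc k)) / c) \<longlonglongrightarrow> (l - l) / c"
    using assms(3) by (intro tendsto_divide tendsto_diff[OF l LIMSEQ_Suc[OF l]] tendsto_const) simp
  then have lim: "(\<lambda>k. (f k - f (Suc k)) / c) \<longlonglongrightarrow> 0" by simp
  have bound: "norm (g k) \<le> (f k - f (Suc k)) / c" for k
    using assms(2)[of k] assms(3) assms(4)[of k] by (simp add: pos_le_divide_eq mult.commute)
  have "\<forall>\<^sub>F k in sequentially. norm (g k) \<le> (f k - f (Suc k)) / c"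
    by (rule always_eventually) (rule allI, rule bound)
  then show ?thesis using lim by (rule Lim_null_comparison)
qed

text \<open>Monotonicity makes the whole sequence of distances converge, and the subsequence
  identifies its limit as 0.\<close>

lemma decseq_dist_subseq_LIMSEQ:
  fixes x :: "nat \<Rightarrow> 'a::metric_space"
  assumes "decseq (\<lambda>k. dist (x k) p)" "strict_mono r" "(x \<circ> r) \<longlonglongrightarrow> p"
  shows "x \<longlonglongrightarrow> p"
proof -
  obtain l where l: "(\<lambda>k. dist (x k) p) \<longlonglongrightarrow> l"
    using decseq_convergent[OF assms(1), of 0] by auto
  have "(\<lambda>k. dist (x (r k)) p) \<longlonglongrightarrow> l"
    using LIMSEQ_subseq_LIMSEQ[OF l assms(2)] by (simp add: o_def)
  moreover have "(\<lambda>k. dist (x (r k)) p) \<longlonglongrightarrow> 0"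
    using assms(3) tendsto_dist_iff by (fastforce simp: o_def)
  ultimately have "l = 0" by (rule LIMSEQ_unique)
  with l show ?thesis using tendsto_dist_iff by blast
qed

text \<open>Dividing the projection inequality of \<open>z k\<close> by \<open>t k\<close> leaves an
  error \<open>norm (x k - z k) * norm (y - z k) / t k\<close>. The lower bound \<open>c\<close> on
  the steps makes it vanish in the limit, while \<open>t k\<close> may vary freely above
  \<open>c\<close>.\<close>

lemma VI_solution_of_projected_limit:
  fixes T :: "real ^ 'n \<Rightarrow> real ^ 'n"
  assumes C: "closed C" "convex C" and T: "continuous_on C T"
    and x: "\<And>k. x k \<in> C" "x \<longlonglongrightarrow> p" and u: "u \<longlonglongrightarrow> 0"
    and z: "\<And>k. z k = closest_point C (x k - t k *\<^sub>R (T (x k) + u k))"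
    and xz: "(\<lambda>k. x k - z k) \<longlonglongrightarrow> 0"
    and t: "0 < c" "\<And>k. c \<le> t k"
  shows "p \<in> VI_solutions C T"
proof -
  have p: "p \<in> C" using closed_sequentially[OF C(1)] x by blast
  have Tx: "(\<lambda>k. T (x k)) \<longlonglongrightarrow> T p"
    using T p x unfolding continuous_on_sequentially by (auto simp: o_def)
  have zp: "z \<longlonglongrightarrow> p" using tendsto_diff[OF x(2) xz] by simp
  have "0 \<le> T p \<bullet> (y - p)" if y: "y \<in> C" for y
  proof -
    have "(T (x k) + u k) \<bullet> (y - z k) + norm (x k - z k) * norm (y - z k) / c \<ge> 0" for k
    proof -
      have tk: "0 < t k" using t(1) t(2)[of k] by linarith
      have "(x k - t k *\<^sub>R (T (x k) + u k) - z k) \<bullet> (y - z k) \<le> 0"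
        unfolding z using C y by (intro closest_point_dot) auto
      then have "(x k - z k) \<bullet> (y - z k) \<le> t k * ((T (x k) + u k) \<bullet> (y - z k))"
        by (simp add: inner_diff_left inner_add_left algebra_simps)
      moreover have "- (norm (x k - z k) * norm (y - z k)) \<le> (x k - z k) \<bullet> (y - z k)"
        using Cauchy_Schwarz_ineq2[of "x k - z k" "y - z k"] by linarith
      ultimately have "- (norm (x k - z k) * norm (y - z k)) \<le> t k * ((T (x k) + u k) \<bullet> (y - z k))"
        by linarith
      then have "- ((T (x k) + u k) \<bullet> (y - z k)) \<le> norm (x k - z k) * norm (y - z k) / t k"
        using tk by (simp add: pos_le_divide_eq mult.commute)
      also have "\<dots> \<le> norm (x k - z k) * norm (y - z k) / c"
        using t(1) t(2)[of k] by (intro divide_left_mono) auto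
      finally show ?thesis by linarith
    qed
    moreover have "(\<lambda>k. (T (x k) + u k) \<bullet> (y - z k) + norm (x k - z k) * norm (y - z k) / c)
        \<longlonglongrightarrow> (T p + 0) \<bullet> (y - p) + norm (0 :: real ^ 'n) * norm (y - p) / c"
      by (intro tendsto_intros Tx u xz zp) (use t in auto)
    ultimately show ?thesis
      by (simp add: LIMSEQ_le_const)
  qed
  with p show ?thesis by (auto simp: VI_solutions_def)
qed

theorem proposition2p19:
  fixes C D :: "(real ^ 'n) set"
    and T :: "real ^ 'n \<Rightarrow> real ^ 'n"
    and L \<delta> \<beta>min \<beta>max :: real
    and \<beta> :: "nat \<Rightarrow> real"
    and x u z v :: "nat \<Rightarrow> real ^ 'n"
  assumes "C \<subseteq> D" and "C \<noteq> {}" and "closed C" and "convex C"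
    and "L-lipschitz_on D T"
    and "VI_solutions C T \<noteq> {}"
    and "VI_solutions C T \<subseteq> dual_VI_solutions C T"
    and "0 < \<delta>" and "\<delta> < 1"
    and "0 < \<beta>min" and "\<beta>min \<le> \<beta>max" and "\<beta>max < 1 / (L + 1)"
    and "\<And>k. \<beta> k \<in> {\<beta>min..\<beta>max}"
    and "extragradient_normal_run C T \<delta> \<beta> x u z v"
  shows "\<exists>s \<in> VI_solutions C T. x \<longlonglongrightarrow> s"
proof -
  \<comment> \<open>The bound on \<open>\<beta>max\<close> says precisely that \<open>q < 1\<close>,
    so the decrease has a positive coefficient independent of \<open>k\<close>.\<close>
  define q where "q = \<beta>max * (L + 1)"
  have L: "0 \<le> L" using assms(5) by (rule lipschitz_on_nonneg)
  have q: "0 < 1 - q\<^sup>2"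
  proof -
    have "0 \<le> q" "q < 1" using assms(10-12) L by (auto simp: q_def field_simps)
    then show ?thesis by (simp add: power_less_one_iff abs_square_less_1)
  qed
  have \<beta>: "\<beta>min \<le> \<beta> k" "\<beta> k * (L + 1) \<le> q" for k
    using assms(13)[of k] L by (auto simp: q_def intro: mult_right_mono)
  have run: "u k \<in> normal_cone C (x k)"
    "norm (u k) \<le> \<delta> * norm (x k - z k)"
    "z k = closest_point C (x k - \<beta> k *\<^sub>R (T (x k) + u k))"
    "v k \<in> normal_cone C (z k)" "norm (v k - u k) \<le> norm (x k - z k)"
    "x (Suc k) = closest_point C (x k - \<beta> k *\<^sub>R (T (z k) + v k))" for k
    using assms(14) unfolding extragradient_normal_run_def by metis+
  have zC: "z k \<in> C" for k
    using run(3) closest_point_in_set assms(2,3) by metis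
  have xC: "x k \<in> C" for k
  proof (cases k)
    case 0
    then show ?thesis using assms(14) by (simp add: extragradient_normal_run_def)
  next
    case (Suc j)
    then show ?thesis using run(6) closest_point_in_set assms(2,3) by metis
  qed
  have TC: "L-lipschitz_on C T" using assms(1,5) lipschitz_on_subset by blast
  have decrease: "(norm (x (Suc k) - s))\<^sup>2 \<le> (norm (x k - s))\<^sup>2 - (1 - q\<^sup>2) * (norm (x k - z k))\<^sup>2"
    if "s \<in> VI_solutions C T" for s k
  \<comment> \<open>Here \<open>a = T (x k) + u k\<close>, \<open>b = T (z k) + v k\<close> and
    \<open>M = L + 1\<close>: \<open>L\<close> comes from the Lipschitz bound, 1 from the rule for
    choosing \<open>v k\<close>.\<close>
  proof (rule extragradient_step_decrease[OF assms(3,4) _ run(3) run(6) _ \<beta>(2)])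
    have s: "s \<in> dual_VI_solutions C T" using that assms(7) by blast
    then show "s \<in> C" by (simp add: dual_VI_solutions_def)
    show "0 \<le> \<beta> k" using \<beta>(1)[of k] assms(10) by linarith
    have "norm (T (x k) + u k - (T (z k) + v k)) \<le> norm (T (x k) - T (z k)) + norm (v k - u k)"
      using norm_triangle_ineq4[of "T (x k) - T (z k)" "v k - u k"] by (simp add: algebra_simps)
    also have "\<dots> \<le> L * norm (x k - z k) + norm (x k - z k)"
      using lipschitz_onD[OF TC xC zC] run(5) by (simp add: dist_norm add_mono)
    finally show "norm (T (x k) + u k - (T (z k) + v k)) \<le> (L + 1) * norm (x k - z k)"
      by (simp add: algebra_simps)
    have "T (z k) \<bullet> (z k - s) \<ge> 0" using s zC by (simp add: dual_VI_solutions_def)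
    moreover have "v k \<bullet> (s - z k) \<le> 0" using run(4) \<open>s \<in> C\<close> by (simp add: normal_cone_def)
    ultimately show "(T (z k) + v k) \<bullet> (s - z k) \<le> 0"
      by (simp add: inner_add_left inner_diff_right)
  qed
  \<comment> \<open>Fejer monotonicity is kept for an arbitrary solution: a known one gives
    boundedness, and the cluster point found later gives convergence.\<close>
  have decseq: "decseq (\<lambda>k. dist (x k) s)" if "s \<in> VI_solutions C T" for s
  proof (rule decseq_SucI)
    fix k
    have "0 \<le> (1 - q\<^sup>2) * (norm (x k - z k))\<^sup>2" using q by simp
    then have "(norm (x (Suc k) - s))\<^sup>2 \<le> (norm (x k - s))\<^sup>2"
      using decrease[OF that, of k] by linarith
    then show "dist (x (Suc k)) s \<le> dist (x k) s"
      by (simp add: dist_norm)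
  qed
  obtain s where s: "s \<in> VI_solutions C T" using assms(6) by blast
  have "(\<lambda>k. (norm (x k - z k))\<^sup>2) \<longlonglongrightarrow> 0"
    using decrement_tendsto_0[of "\<lambda>k. (norm (x k - s))\<^sup>2", OF _ _ q decrease[OF s]] by simp
  then have nxz: "(\<lambda>k. norm (x k - z k)) \<longlonglongrightarrow> 0"
    using tendsto_real_sqrt by fastforce
  then have xz: "(\<lambda>k. x k - z k) \<longlonglongrightarrow> 0" by (rule tendsto_norm_zero_cancel)
  \<comment> \<open>The size restriction on \<open>u k\<close> makes it vanish together with
    \<open>x k - z k\<close>.\<close>
  have "(\<lambda>k. \<delta> * norm (x k - z k)) \<longlonglongrightarrow> 0" using tendsto_mult_right_zero[OF nxz] .
  then have u: "u \<longlonglongrightarrow> 0"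
    by (rule Lim_null_comparison[rotated]) (simp add: run(2))
  \<comment> \<open>The iterates never leave this compact ball, so a cluster point \<open>p\<close>
    exists.\<close>
  have "x k \<in> cball s (dist (x 0) s)" for k
    using decseqD[OF decseq[OF s], of 0 k] by (simp add: dist_commute)
  then obtain p r where r: "strict_mono (r :: nat \<Rightarrow> nat)" "(x \<circ> r) \<longlonglongrightarrow> p"
    using compact_imp_seq_compact[OF compact_cball] unfolding seq_compact_def by metis
  have "p \<in> VI_solutions C T"
  proof (rule VI_solution_of_projected_limit[OF assms(3,4) _ _ r(2) _ _ _ assms(10)])
    show "continuous_on C T" using TC by (rule lipschitz_on_continuous_on)
    show "(u \<circ> r) \<longlonglongrightarrow> 0" using u r(1) by (rule LIMSEQ_subseq_LIMSEQ)
    show "(z \<circ> r) k = closest_point C ((x \<circ> r) k - (\<beta> \<circ> r) k *\<^sub>R (T ((x \<circ> r) k) + (u \<circ> r) k))" for k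
      using run(3) by simp
    show "(\<lambda>k. (x \<circ> r) k - (z \<circ> r) k) \<longlonglongrightarrow> 0"
      using LIMSEQ_subseq_LIMSEQ[OF xz r(1)] by (simp add: o_def)
  qed (simp_all add: xC \<beta>(1))
  \<comment> \<open>Since \<open>p\<close> is itself a solution, the distances to \<open>p\<close>
    decrease, and convergence along \<open>r\<close> extends to all of \<open>x\<close>.\<close>
  then show ?thesis using decseq_dist_subseq_LIMSEQ[OF decseq r] by blast
qed

end
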